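(* Let $H_1$ and $H_2$ be symmetric complex Hadamard matrices of sizes $d_1\times d_1$ and $d_2\times d_2$, let $H=H_1\otimes H_2$, and let $G$ be a graph on $n$ vertices. Then, up to permutation of qudits, $|\psi_{G,H}\rangle=|\psi_{G,H_1}\rangle\otimes|\psi_{G,H_2}\rangle$; that is, under the identification $(\mathbb{C}^{d_1d_2})^{\otimes n}\cong(\mathbb{C}^{d_1}\otimes\mathbb{C}^{d_2})^{\otimes n}\cong(\mathbb{C}^{d_1})^{\otimes n}\otimes(\mathbb{C}^{d_2})^{\otimes n}$ (the second isomorphism collecting the $\mathbb{C}^{d_1}$ factors and the $\mathbb{C}^{d_2}$ factors), the two states coincide.
   Context: A complex Hadamard matrix of size $d$ is a $d\times d$ complex matrix $H=(h_{ij})_{i,j=0}^{d-1}$ with $|h_{ij}|=1$ for all $i,j$ and $H^\dagger H=dI_d$; it is symmetric if $H=H^T$. The tensor product of two symmetric complex Hadamard matrices is again one. A qudit has state space $\mathbb{C}^d$ with computational basis $|0\rangle,\dots,|d-1\rangle$; $\mathbb{C}^{d_1d_2}$ is identified with $\mathbb{C}^{d_1}\otimes\mathbb{C}^{d_2}$ compatibly with the Kronecker product, so that basis vectors of $\mathbb{C}^{d_1d_2}$ are $|i_1i_2\rangle$, the vector $|0\rangle$ corresponds to $|00\rangle$, and $H_{i_1i_2,j_1j_2}=(H_1)_{i_1j_1}(H_2)_{i_2j_2}$. For symmetric $H$ of size $d$, the generalized controlled-$Z$ gate $C^H$ is the diagonal operator on $\mathbb{C}^d\otimes\mathbb{C}^d$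 with $C^H|ij\rangle=h_{ij}|ij\rangle$; $C^H_{ab}$ denotes this gate acting on qudits $a,b$. For a (finite, simple) undirected graph $G$ with vertex set $V(G)=\{1,\dots,n\}$ and edge set $E(G)$, the generalized graph state in $(\mathbb{C}^d)^{\otimes n}$ is $$|\psi_{G,H}\rangle=\mathcal{U}_{G,H}|0\rangle^{\otimes n},\qquad \mathcal{U}_{G,H}=\frac{1}{d^{n/2}}\Big(\prod_{ab\in E(G)}C^H_{ab}\Big)H^{\otimes n}.$$ *)

theory Defs
  imports "HOL-Analysis.Analysis"
begin

text \<open>
  A finite type \<open>'d\<close> indexes the computational basis of \<open>\<complex>\<^sup>d\<close>, \<open>d = CARD('d)\<close>; its element \<open>0\<close> is the
  label of \<open>|0\<rangle>\<close>, and class \<open>zero\<close> requires nothing of it. In particular \<open>0 = (0, 0)\<close> in a product type.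
  Index types are multiplied to form tensor products: \<open>'i \<times> 'j\<close> labels the basis \<open>|ij\<rangle>\<close> of
  \<open>\<complex>\<^sup>i \<otimes> \<complex>\<^sup>j\<close>, and \<open>'n \<Rightarrow> 'd\<close> labels the basis of the \<open>n\<close>-fold tensor power of \<open>\<complex>\<^sup>d\<close>, \<open>n = CARD('n)\<close>,
  by the functions \<open>x\<close> that assign to each qudit \<open>a\<close> its label \<open>x a\<close>.
\<close>

subsection \<open>Symmetric complex Hadamard matrices\<close>

definition conj_transpose :: "complex ^ 'm ^ 'n \<Rightarrow> complex ^ 'n ^ 'm" where
  "conj_transpose A = (\<chi> i j. cnj (A $ j $ i))"

definition complex_hadamard :: "complex ^ 'd ^ 'd \<Rightarrow> bool" where
  "complex_hadamard H \<longleftrightarrow>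
     (\<forall>i j. cmod (H $ i $ j) = 1) \<and> conj_transpose H ** H = mat (of_nat CARD('d))"

definition symmetric_hadamard :: "complex ^ 'd ^ 'd \<Rightarrow> bool" where
  "symmetric_hadamard H \<longleftrightarrow> complex_hadamard H \<and> transpose H = H"

subsection \<open>Tensor products\<close>

definition vec_tensor :: "complex ^ 'i \<Rightarrow> complex ^ 'j \<Rightarrow> complex ^ ('i \<times> 'j)"
    (infixr "\<otimes>\<^sub>v" 70) where
  "u \<otimes>\<^sub>v v = (\<chi> p. u $ fst p * v $ snd p)"

definition kronecker :: "complex ^ 'i ^ 'i \<Rightarrow> complex ^ 'j ^ 'j \<Rightarrow> complex ^ ('i \<times> 'j) ^ ('i \<times> 'j)"
    (infixr "\<otimes>\<^sub>m" 70) where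
  "A \<otimes>\<^sub>m B = (\<chi> p q. A $ fst p $ fst q * B $ snd p $ snd q)"

definition big_vec_tensor :: "('n \<Rightarrow> complex ^ 'd) \<Rightarrow> complex ^ ('n::finite \<Rightarrow> 'd::finite)" where
  "big_vec_tensor v = (\<chi> x. \<Prod>a\<in>UNIV. v a $ x a)"

definition tensor_power :: "complex ^ 'd ^ 'd \<Rightarrow> complex ^ ('n \<Rightarrow> 'd) ^ ('n::finite \<Rightarrow> 'd::finite)" where
  "tensor_power A = (\<chi> x y. \<Prod>a\<in>UNIV. A $ x a $ y a)"

subsection \<open>Generalized controlled-\<open>Z\<close> gates and graph states\<close>

definition controlled_Z :: "complex ^ 'd ^ 'd \<Rightarrow> complex ^ ('d \<times> 'd) ^ ('d \<times> 'd)" where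
  "controlled_Z H = (\<chi> p q. if p = q then H $ fst p $ snd p else 0)"

definition on_qudits ::
  "'n \<Rightarrow> 'n \<Rightarrow> complex ^ ('d \<times> 'd) ^ ('d \<times> 'd) \<Rightarrow> complex ^ ('n \<Rightarrow> 'd) ^ ('n::finite \<Rightarrow> 'd::finite)" where
  "on_qudits a b U =
     (\<chi> x y. if \<forall>c. c \<noteq> a \<and> c \<noteq> b \<longrightarrow> x c = y c then U $ (x a, x b) $ (y a, y b) else 0)"

definition simple_graph :: "'n set set \<Rightarrow> bool" where
  "simple_graph E \<longleftrightarrow> (\<forall>e\<in>E. card e = 2)"

text \<open>
  The vertices are all of \<open>'n\<close>. Its linear order only names the ends of an edge; for symmetric \<open>H\<close>
  the gate is the same with the ends exchanged, see \<open>on_qudits_controlled_Z_swap\<close>.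
\<close>

definition edge_gate ::
  "complex ^ 'd ^ 'd \<Rightarrow> 'n set \<Rightarrow> complex ^ ('n \<Rightarrow> 'd) ^ ('n::{finite,linorder} \<Rightarrow> 'd::finite)" where
  "edge_gate H e = on_qudits (Min e) (Max e) (controlled_Z H)"

text \<open>
  Matrix product is not a commutative monoid operation, so the product over the edges is a fold; it
  is well defined since the gates commute, see \<open>comp_fun_commute_edge_gate\<close>.
\<close>

definition edge_gates ::
  "'n set set \<Rightarrow> complex ^ 'd ^ 'd \<Rightarrow> complex ^ ('n \<Rightarrow> 'd) ^ ('n::{finite,linorder} \<Rightarrow> 'd::finite)" where
  "edge_gates E H = Finite_Set.fold (\<lambda>e M. edge_gate H e ** M) (mat 1) E"

definition graph_unitary ::
  "'n set set \<Rightarrow> complex ^ 'd ^ 'd \<Rightarrow> complex ^ ('n \<Rightarrow> 'd) ^ ('n::{finite,linorder} \<Rightarrow> 'd::finite)" where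
  "graph_unitary E H =
     (1 / real CARD('d) powr (real CARD('n) / 2)) *\<^sub>R (edge_gates E H ** tensor_power H)"

definition graph_state ::
  "('n::{finite,linorder}) set set \<Rightarrow> complex ^ 'd::{finite,zero} ^ 'd::{finite,zero} \<Rightarrow> complex ^ ('n \<Rightarrow> 'd)" where
  "graph_state E H = graph_unitary E H *v big_vec_tensor (\<lambda>_. axis 0 1)"

subsection \<open>Collecting the factors\<close>

text \<open>
  The isomorphism that regroups \<open>n\<close> qudits of dimension \<open>d\<^sub>1d\<^sub>2\<close> into \<open>n\<close> of dimension \<open>d\<^sub>1\<close> followed by
  \<open>n\<close> of dimension \<open>d\<^sub>2\<close>. Being linear, it is determined by \<open>collect_factors_big_vec_tensor\<close>.
\<close>

definition collect_factors ::
  "complex ^ ('n \<Rightarrow> 'd1 \<times> 'd2) \<Rightarrow> complex ^ (('n::finite \<Rightarrow> 'd1::finite) \<times> ('n \<Rightarrow> 'd2::finite))" where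
  "collect_factors \<psi> = (\<chi> p. \<psi> $ (\<lambda>a. (fst p a, snd p a)))"

lemma collect_factors_big_vec_tensor:
  "collect_factors (big_vec_tensor (\<lambda>a. u a \<otimes>\<^sub>v v a)) = big_vec_tensor u \<otimes>\<^sub>v big_vec_tensor v"
  by (simp add: collect_factors_def big_vec_tensor_def vec_tensor_def vec_eq_iff prod.distrib)

lemma linear_collect_factors: "Vector_Spaces.linear (*s) (*s) collect_factors"
  by unfold_locales (simp_all add: collect_factors_def vec_eq_iff algebra_simps)

lemma bij_collect_factors:
  "bij (collect_factors :: complex ^ ('n::finite \<Rightarrow> 'd1::finite \<times> 'd2::finite) \<Rightarrow> _)"
  by (rule o_bij[where g = "\<lambda>\<phi>. \<chi> x. \<phi> $ (\<lambda>a. fst (x a), \<lambda>a. snd (x a))"])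
     (auto simp: collect_factors_def fun_eq_iff vec_eq_iff)

subsection \<open>Sanity checks\<close>

lemma on_qudits_controlled_Z:
  "on_qudits a b (controlled_Z H) = (\<chi> x y. if x = y then H $ x a $ x b else 0)"
  by (auto simp: on_qudits_def controlled_Z_def vec_eq_iff fun_eq_iff)

lemma on_qudits_controlled_Z_swap:
  assumes "transpose H = H"
  shows "on_qudits a b (controlled_Z H) = on_qudits b a (controlled_Z H)"
proof -
  have sym: "H $ i $ j = H $ j $ i" for i j
    using assms by (metis transpose_def vec_lambda_beta)
  then show ?thesis
    by (auto simp: on_qudits_controlled_Z vec_eq_iff intro: sym)
qed

lemma edge_gate_mult:
  "edge_gate H e ** M = (\<chi> x y. H $ x (Min e) $ x (Max e) * M $ x $ y)"
proof -
  have *: "(if x = z then c else 0) * M $ z $ y = (if x = z then c * M $ z $ y else 0)" for x y z c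
    by simp
  show ?thesis
    unfolding edge_gate_def on_qudits_controlled_Z matrix_matrix_mult_def
    by (simp add: vec_eq_iff *)
qed

lemma comp_fun_commute_edge_gate:
  "comp_fun_commute (\<lambda>e M. edge_gate H e ** M)"
  by unfold_locales (auto simp: edge_gate_mult fun_eq_iff vec_eq_iff)

lemma symmetric_hadamard_kronecker:
  fixes H1 :: "complex ^ 'd1 ^ 'd1" and H2 :: "complex ^ 'd2 ^ 'd2"
  assumes "symmetric_hadamard H1" "symmetric_hadamard H2"
  shows "symmetric_hadamard (H1 \<otimes>\<^sub>m H2)"
proof -
  have h1: "(\<Sum>k\<in>UNIV. cnj (H1 $ k $ i) * H1 $ k $ j) = (if i = j then of_nat CARD('d1) else 0)" for i j
    using assms(1) unfolding symmetric_hadamard_def complex_hadamard_def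
    by (simp add: vec_eq_iff matrix_matrix_mult_def conj_transpose_def mat_def)
  have h2: "(\<Sum>k\<in>UNIV. cnj (H2 $ k $ i) * H2 $ k $ j) = (if i = j then of_nat CARD('d2) else 0)" for i j
    using assms(2) unfolding symmetric_hadamard_def complex_hadamard_def
    by (simp add: vec_eq_iff matrix_matrix_mult_def conj_transpose_def mat_def)
  have "(\<Sum>k\<in>UNIV. cnj ((H1 \<otimes>\<^sub>m H2) $ k $ i) * (H1 \<otimes>\<^sub>m H2) $ k $ j)
      = (\<Sum>k\<in>UNIV. \<Sum>l\<in>UNIV. (cnj (H1 $ k $ fst i) * H1 $ k $ fst j) *
           (cnj (H2 $ l $ snd i) * H2 $ l $ snd j))" for i j
    by (simp add: kronecker_def sum.cartesian_product mult_ac case_prod_beta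
        flip: UNIV_Times_UNIV)
  then have "(\<Sum>k\<in>UNIV. cnj ((H1 \<otimes>\<^sub>m H2) $ k $ i) * (H1 \<otimes>\<^sub>m H2) $ k $ j)
      = (if i = j then of_nat CARD('d1 \<times> 'd2) else 0)" for i j
    by (simp add: h1 h2 prod_eq_iff flip: sum_product)
  then have "conj_transpose (H1 \<otimes>\<^sub>m H2) ** (H1 \<otimes>\<^sub>m H2) = mat (of_nat CARD('d1 \<times> 'd2))"
    by (simp add: vec_eq_iff matrix_matrix_mult_def conj_transpose_def mat_def)
  with assms show ?thesis
    by (auto simp: symmetric_hadamard_def complex_hadamard_def kronecker_def norm_mult
        transpose_def vec_eq_iff)
qed

end

theory Submission
  imports Defs
begin

text \<open>
  The amplitude of \<open>|\<psi>\<^bsub>G,H\<^esub>\<rangle>\<close> at \<open>|x\<rangle>\<close> is \<open>d\<close> to the power \<open>-n/2\<close> times a product of one entry of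
  \<open>H\<close> for each edge and one for each vertex. Entries of \<open>H\<^sub>1 \<otimes> H\<^sub>2\<close> are products of entries of \<open>H\<^sub>1\<close>
  and \<open>H\<^sub>2\<close>, and \<open>d = d\<^sub>1d\<^sub>2\<close>, so every factor splits.
\<close>

text \<open>Every edge gate is diagonal, so it only rescales row \<open>x\<close>. Carrying
  \<open>M\<close> along lets the induction peel off one gate by associativity.\<close>

lemma edge_gates_mult:
  "edge_gates E H ** M = (\<chi> x y. (\<Prod>e\<in>E. H $ x (Min e) $ x (Max e)) * M $ x $ y)"
proof -
  interpret comp_fun_commute "\<lambda>e M. edge_gate H e ** M"
    by (rule comp_fun_commute_edge_gate)
  have "finite E"
    by simp
  then show ?thesis
  proof (induction E rule: finite_induct)
    case empty
    show ?case
      by (simp add: edge_gates_def vec_eq_iff)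
  next
    case (insert e E)
    have "edge_gates (insert e E) H ** M = edge_gate H e ** (edge_gates E H ** M)"
      using insert.hyps by (simp add: edge_gates_def matrix_mul_assoc)
    then show ?case
      using insert by (simp add: edge_gate_mult vec_eq_iff mult.assoc)
  qed
qed

lemma big_vec_tensor_axis:
  "big_vec_tensor (\<lambda>a. axis (z a) 1) = axis z 1"
proof -
  have "(\<Prod>a\<in>UNIV. axis (z a) (1::complex) $ x a) = axis z 1 $ x" for x
  proof (cases "x = z")
    case False
    then obtain a where "x a \<noteq> z a"
      by blast
    then have "axis (z a) (1::complex) $ x a = 0"
      by (simp add: axis_def)
    then have "(\<Prod>a\<in>UNIV. axis (z a) (1::complex) $ x a) = 0"
      by (intro prod_zero) auto
    with False show ?thesis
      by (simp add: axis_def)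
  qed (simp add: axis_def)
  then show ?thesis
    by (simp add: big_vec_tensor_def vec_eq_iff)
qed

text \<open>The input is the basis vector labelled by the constant function \<open>0\<close>, so it
  selects a single column of \<open>tensor_power H\<close>.\<close>

lemma graph_state_nth:
  fixes H :: "complex ^ 'd::{finite,zero} ^ 'd::{finite,zero}" and E :: "'n::{finite,linorder} set set"
  shows "graph_state E H $ x = complex_of_real (1 / real CARD('d) powr (real CARD('n) / 2)) *
    ((\<Prod>e\<in>E. H $ x (Min e) $ x (Max e)) * (\<Prod>a\<in>UNIV. H $ x a $ 0))"
  unfolding graph_state_def graph_unitary_def edge_gates_mult big_vec_tensor_axis
  by (simp add: matrix_vector_mult_def axis_def tensor_power_def if_distrib[of "(*) _"]
      scaleR_conv_of_real[where 'a = complex] cong: if_cong)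

theorem proposition8:
  fixes H1 :: "complex ^ 'd1::{finite,zero} ^ 'd1::{finite,zero}"
    and H2 :: "complex ^ 'd2::{finite,zero} ^ 'd2::{finite,zero}"
    and H :: "complex ^ ('d1 \<times> 'd2) ^ ('d1 \<times> 'd2)"
    and E :: "'n::{finite,linorder} set set"
  assumes "symmetric_hadamard H1" and "symmetric_hadamard H2"
    and "H = H1 \<otimes>\<^sub>m H2"
    and "simple_graph E"
  shows "collect_factors (graph_state E H) = graph_state E H1 \<otimes>\<^sub>v graph_state E H2"
  \<comment> \<open>\<open>0\<close> of the product type has both components \<open>0\<close>, so
    column \<open>0\<close> of \<open>H\<close> splits too; \<open>powr_mult\<close> splits the
    normalization.\<close>
  unfolding assms(3)
  by (simp add: vec_eq_iff collect_factors_def vec_tensor_def graph_state_nth kronecker_def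
      prod.distrib powr_mult mult_ac)

end
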